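(* Let $T$ be a tree with radius ${\rm rad}(T)\geqslant 3$ and distinguishing number $D(T)=2$. Then the complement $\overline{T}$ of $T$ is a connected $2$-self-centered graph that is not bipartite.
   Context: Graphs are simple, and $\overline{G}$ denotes the complement of a graph $G$. The distance $d_G(u,v)$ between two vertices $u,v$ of $G$ is the length of a shortest $u$–$v$ path if one exists, and $d_G(u,v)=\infty$ otherwise. The eccentricity $e_G(v)$ of a vertex $v$ is the distance between $v$ and a vertex farthest from $v$. The radius ${\rm rad}(G)$ is the minimum eccentricity among the vertices of $G$, and the diameter ${\rm diam}(G)$ is the maximum eccentricity. A graph $G$ is called $k$-self-centered if ${\rm diam}(G)={\rm rad}(G)=k$. A labeling $\phi: V(G)\to\{1,2,\ldots,r\}$ is $r$-distinguishing if no nontrivial automorphism of $G$ preserves all the vertex labels, i.e. for every $\sigma\in{\rm Aut}(G)$ with $\sigma\neq {\rm id}$ there is a vertex $x$ such that $\phi(x)\neq\phi(\sigma(x))$. The distinguishing number of $G$ is $D(G)=\min\{r \mid G \text{ has a labeling that is } r\text{-distinguishing}\}$. *)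

theory Defs
  imports "Graph_Theory.Digraph_Component" "HOL-Library.Extended_Nat"
    "HOL-Library.FuncSet" "HOL-Combinatorics.Permutations"
begin

text \<open>
  A simple undirected graph is a symmetric, loop-free \<^typ>\<open>'a pair_pre_digraph\<close>
  (locale \<^locale>\<open>pair_bidirected_digraph\<close>), an edge \<open>uv\<close> being the pair of arcs
  \<open>(u,v)\<close>, \<open>(v,u)\<close>. Finiteness is not assumed.
\<close>

definition complement :: "'a pair_pre_digraph \<Rightarrow> 'a pair_pre_digraph" where
  "complement G = \<lparr> pverts = pverts G,
     parcs = {(u, v). u \<in> pverts G \<and> v \<in> pverts G \<and> u \<noteq> v \<and> (u, v) \<notin> parcs G} \<rparr>"

text \<open>
  The library constants \<^const>\<open>forest\<close> and \<^const>\<open>tree\<close> are about directed graphs: a single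
  undirected edge already gives the directed cycle \<open>u, v, u\<close>. Cycles of a simple graph are
  the directed ones of length at least 3. The library's \<^const>\<open>connected\<close> excludes the empty graph.
\<close>

definition undirected_tree :: "'a pair_pre_digraph \<Rightarrow> bool" where
  "undirected_tree G \<longleftrightarrow> pair_bidirected_digraph G \<and> connected (with_proj G)
     \<and> \<not> (\<exists>p. pre_digraph.cycle (with_proj G) p \<and> 3 \<le> length p)"

definition bipartite :: "'a pair_pre_digraph \<Rightarrow> bool" where
  "bipartite G \<longleftrightarrow> (\<exists>A B. A \<union> B = pverts G \<and> A \<inter> B = {}
     \<and> (\<forall>(u, v) \<in> parcs G. (u \<in> A \<and> v \<in> B) \<or> (u \<in> B \<and> v \<in> A)))"

text \<open>
  Distances take values in \<^typ>\<open>enat\<close>, where the infimum of the empty set is \<open>\<infinity>\<close> and every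
  nonempty infimum is attained. The suprema below are maxima whenever the graph is
  finite and nonempty.
\<close>

definition distance :: "'a pair_pre_digraph \<Rightarrow> 'a \<Rightarrow> 'a \<Rightarrow> enat" where
  "distance G u v = (INF p \<in> {p. pre_digraph.apath (with_proj G) u p v}. enat (length p))"

definition eccentricity :: "'a pair_pre_digraph \<Rightarrow> 'a \<Rightarrow> enat" where
  "eccentricity G v = (SUP u \<in> pverts G. distance G v u)"

definition radius :: "'a pair_pre_digraph \<Rightarrow> enat" where
  "radius G = (INF v \<in> pverts G. eccentricity G v)"

definition diameter :: "'a pair_pre_digraph \<Rightarrow> enat" where
  "diameter G = (SUP v \<in> pverts G. eccentricity G v)"

definition self_centered :: "nat \<Rightarrow> 'a pair_pre_digraph \<Rightarrow> bool" where
  "self_centered k G \<longleftrightarrow> diameter G = enat k \<and> radius G = enat k"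

text \<open>
  A map with \<open>\<sigma> permutes V\<close> is the identity outside \<open>V\<close>, so the trivial automorphism is \<^const>\<open>id\<close>.
\<close>

definition automorphisms :: "'a pair_pre_digraph \<Rightarrow> ('a \<Rightarrow> 'a) set" where
  "automorphisms G = {\<sigma>. \<sigma> permutes pverts G
     \<and> (\<forall>u \<in> pverts G. \<forall>v \<in> pverts G. (\<sigma> u, \<sigma> v) \<in> parcs G \<longleftrightarrow> (u, v) \<in> parcs G)}"

definition distinguishing_labeling :: "'a pair_pre_digraph \<Rightarrow> nat \<Rightarrow> ('a \<Rightarrow> nat) \<Rightarrow> bool" where
  "distinguishing_labeling G r \<phi> \<longleftrightarrow> \<phi> \<in> pverts G \<rightarrow> {1..r}
     \<and> (\<forall>\<sigma> \<in> automorphisms G. \<sigma> \<noteq> id \<longrightarrow> (\<exists>x \<in> pverts G. \<phi> x \<noteq> \<phi> (\<sigma> x)))"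

text \<open>The value is \<open>\<infinity>\<close> if no finite number of labels suffices (possible only for infinite graphs).\<close>

definition distinguishing_number :: "'a pair_pre_digraph \<Rightarrow> enat" where
  "distinguishing_number G = (INF r \<in> {r. \<exists>\<phi>. distinguishing_labeling G r \<phi>}. enat r)"

end

theory Submission
  imports Defs
begin

text \<open>
  What makes this work is that \<open>T\<close> is connected with radius at least 3. If every vertex were
  equal or adjacent to one of the ends of an edge \<open>uv\<close>, then \<open>u\<close> would reach everything within two
  steps. Hence the ends of each edge \<open>uv\<close> of \<open>T\<close> have a common non-neighbour \<open>w\<close>
  (\<open>edge_common_nonneighbour\<close>), and \<open>u, w, v\<close> is a path of length two in the complement. So any two
  vertices are at distance at most 2 in the complement: those that are adjacent in \<open>T\<close> by
  this path, the others by an edge. Conversely each vertex has a \<open>T\<close>-neighbour, which is at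
  distance at least 2 from it in the complement. All eccentricities of the complement are therefore
  exactly 2.

  In a bipartition of the complement, the path \<open>u, w, v\<close> puts the ends of each edge of \<open>T\<close> on the
  same side. As \<open>T\<close> is connected, all vertices are then on one side, which contradicts
  the existence of the edge \<open>uw\<close> of the complement.
\<close>

section \<open>Distances and eccentricities\<close>

lemma distance_le_apath:
  assumes "pre_digraph.apath (with_proj G) u p v"
  shows "distance G u v \<le> enat (length p)"
  unfolding distance_def using assms by (intro INF_lower) simp

text \<open>
  Distances are defined by paths without repeated vertices; cutting closed subwalks out of a walk
  yields such a path and does not lengthen it. This allows bounds by explicit walks without a
  check that their vertices are distinct.
\<close>

lemma (in pair_wf_digraph) distance_le_awalk:
  assumes "awalk u p v"
  shows "distance G u v \<le> enat (length p)"
proof -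
  have "length (awalk_to_apath p) \<le> length p"
    using assms
  proof (induct rule: awalk_to_apath_induct)
    case (path p)
    then show ?case by (auto simp: awalk_to_apath.simps)
  next
    case (decomp p q r s)
    then have "p = q @ r @ s"
      using awalk_cyc_decomp_has_prop by (metis is_awalk_cyc_decomp.simps)
    then show ?case
      using decomp(4) step_awalk_to_apath[OF decomp(1-3)] by simp
  qed
  then show ?thesis
    using distance_le_apath[OF apath_awalk_to_apath[OF assms]] order_trans by fastforce
qed

lemma (in pair_wf_digraph) distance_refl_le:
  "u \<in> pverts G \<Longrightarrow> distance G u u \<le> 0"
  using distance_le_awalk[of u "[]" u] by (simp add: awalk_Nil_iff zero_enat_def)

lemma (in pair_wf_digraph) distance_le_1:
  "(u, v) \<in> parcs G \<Longrightarrow> distance G u v \<le> 1"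
  using distance_le_awalk[of u "[(u, v)]" v]
  by (auto simp: awalk_simps one_enat_def dest: wellformed')

lemma (in pair_wf_digraph) distance_le_2:
  "(u, w) \<in> parcs G \<Longrightarrow> (w, v) \<in> parcs G \<Longrightarrow> distance G u v \<le> 2"
  using distance_le_awalk[of u "[(u, w), (w, v)]" v]
  by (auto simp: awalk_simps numeral_eq_enat numeral_2_eq_2 dest: wellformed')

lemma (in pair_wf_digraph) distance_ge_2:
  assumes "u \<noteq> v" "(u, v) \<notin> parcs G"
  shows "2 \<le> distance G u v"
proof -
  have "2 \<le> length p" if "apath u p v" for p
    using that assms by (cases p rule: remdups_adj.cases) (auto simp: apath_simps)
  then show ?thesis
    unfolding distance_def by (intro INF_greatest) (simp add: numeral_eq_enat)
qed

lemma exists_vertex_beyond_radius: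
  assumes "n < radius G" "v \<in> pverts G"
  shows "\<exists>x \<in> pverts G. n < distance G v x"
proof -
  have "n < eccentricity G v"
    using assms by (auto simp: radius_def intro: less_le_trans INF_lower)
  then show ?thesis
    by (simp add: eccentricity_def less_SUP_iff)
qed

lemma self_centeredI:
  assumes "pverts G \<noteq> {}" "\<And>v. v \<in> pverts G \<Longrightarrow> eccentricity G v = enat k"
  shows "self_centered k G"
  using assms by (simp add: self_centered_def diameter_def radius_def)

section \<open>Connected graphs\<close>

lemma connected_imp_constant:
  assumes "connected (with_proj G)"
    and "\<And>x y. (x, y) \<in> parcs G \<Longrightarrow> f x = f y"
    and "u \<in> pverts G" "v \<in> pverts G"
  shows "f u = f v"
proof -
  have "(u, v) \<in> rtrancl_on (pverts G) ((parcs G)\<^sup>s)"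
    using assms(1,3,4) by (simp add: connected_conv)
  then show ?thesis
    by induct (auto simp: symcl_def dest: assms(2))
qed

text \<open>
  A vertex \<open>v\<close> of a graph with positive radius is not the only one. If it were isolated, the indicator
  function of \<open>{v}\<close> would be constant along edges without being constant.
\<close>

lemma connected_imp_neighbour:
  assumes "pair_bidirected_digraph G" "connected (with_proj G)" "0 < radius G" "v \<in> pverts G"
  shows "\<exists>w. (v, w) \<in> parcs G"
proof (rule ccontr)
  interpret pair_bidirected_digraph G by fact
  obtain u where u: "u \<in> pverts G" "0 < distance G v u"
    using exists_vertex_beyond_radius[OF assms(3,4)] by auto
  then have "u \<noteq> v"
    using distance_refl_le[OF assms(4)] by auto
  assume "\<nexists>w. (v, w) \<in> parcs G"
  then have "(x = v) = (y = v)" if "(x, y) \<in> parcs G" for x y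
    using that arcs_symmetric by blast
  from connected_imp_constant[OF assms(2), of "\<lambda>x. x = v", OF this u(1) assms(4)] \<open>u \<noteq> v\<close>
  show False by simp
qed

section \<open>Complements of graphs of radius at least 3\<close>

lemma pverts_complement [simp]: "pverts (complement G) = pverts G"
  by (simp add: complement_def)

lemma parcs_complement_iff [simp]:
  "(u, v) \<in> parcs (complement G)
    \<longleftrightarrow> u \<in> pverts G \<and> v \<in> pverts G \<and> u \<noteq> v \<and> (u, v) \<notin> parcs G"
  by (simp add: complement_def)

lemma pair_wf_digraph_complement: "pair_wf_digraph (complement G)"
  by unfold_locales auto

text \<open>
  The witness is any vertex at distance at least 3 from \<open>u\<close>.
\<close>

lemma edge_common_nonneighbour:
  assumes "pair_bidirected_digraph G" "3 \<le> radius G" "(u, v) \<in> parcs G"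
  shows "\<exists>w. (u, w) \<in> parcs (complement G) \<and> (w, v) \<in> parcs (complement G)"
proof -
  interpret pair_bidirected_digraph G by fact
  have uv: "u \<in> pverts G" "v \<in> pverts G"
    using assms(3) by (auto intro: wellformed')
  have "2 < radius G"
    using assms(2) by (rule less_le_trans[rotated]) simp
  then obtain w where w: "w \<in> pverts G" "2 < distance G u w"
    using exists_vertex_beyond_radius[OF _ uv(1)] by auto
  have far: "\<not> distance G u w \<le> n" if "n \<le> 2" for n
    using w(2) that by (meson leD order_trans)
  have "\<not> distance G u w \<le> 2" "\<not> distance G u w \<le> 1" "\<not> distance G u w \<le> 0"
    by (rule far, simp)+
  then have "w \<noteq> u" "(u, w) \<notin> parcs G" "w \<noteq> v" "(v, w) \<notin> parcs G"
    using distance_refl_le[OF uv(1)] distance_le_1 distance_le_2[OF assms(3)] assms(3) by auto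
  then show ?thesis
    using uv w(1) arcs_symmetric by auto
qed

lemma complement_path_le_2:
  assumes "pair_bidirected_digraph G" "3 \<le> radius G"
    and "u \<in> pverts G" "v \<in> pverts G" "u \<noteq> v"
  shows "(u, v) \<in> parcs (complement G)
    \<or> (\<exists>w. (u, w) \<in> parcs (complement G) \<and> (w, v) \<in> parcs (complement G))"
  using edge_common_nonneighbour[OF assms(1,2)] assms(3-5) by (cases "(u, v) \<in> parcs G") auto

lemma connected_complement:
  assumes "pair_bidirected_digraph G" "3 \<le> radius G" "pverts G \<noteq> {}"
  shows "connected (with_proj (complement G))"
proof -
  interpret C: pair_wf_digraph "complement G" by (rule pair_wf_digraph_complement)
  let ?R = "rtrancl_on (pverts G) ((parcs (complement G))\<^sup>s)"
  have arc: "(x, y) \<in> ?R" if "(x, y) \<in> parcs (complement G)" for x y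
    using that by (intro rtrancl_on_into_rtrancl_on[OF rtrancl_on_refl]) (auto simp: symcl_def)
  have "(u, v) \<in> ?R" if "u \<in> pverts G" "v \<in> pverts G" for u v
    using complement_path_le_2[OF assms(1,2) that] arc rtrancl_on_trans rtrancl_on_refl[OF that(1)]
    by metis
  with assms(3) show ?thesis
    by (simp add: connected_conv)
qed

lemma eccentricity_complement:
  assumes "pair_bidirected_digraph G" "connected (with_proj G)" "3 \<le> radius G" "v \<in> pverts G"
  shows "eccentricity (complement G) v = 2"
proof (rule antisym)
  interpret pair_bidirected_digraph G by fact
  interpret C: pair_wf_digraph "complement G" by (rule pair_wf_digraph_complement)
  have "distance (complement G) v u \<le> 2" if "u \<in> pverts G" for u
  proof (cases "u = v")
    case True
    then show ?thesis
      using C.distance_refl_le[of v] assms(4) by (auto intro: order_trans)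
  next
    case False
    have "distance (complement G) v u \<le> 2" if "distance (complement G) v u \<le> 1"
      using that by (rule order_trans) simp
    then show ?thesis
      using complement_path_le_2[OF assms(1,3,4) that] False C.distance_le_1 C.distance_le_2 by blast
  qed
  then show "eccentricity (complement G) v \<le> 2"
    by (auto simp: eccentricity_def intro: SUP_least)
  have "0 < radius G"
    using assms(3) by (rule less_le_trans[rotated]) simp
  then obtain u where "(v, u) \<in> parcs G"
    using connected_imp_neighbour[OF assms(1,2) _ assms(4)] by blast
  then have "u \<in> pverts G" "2 \<le> distance (complement G) v u"
    using C.distance_ge_2[of v u] no_loops by (auto intro: wellformed')
  then show "2 \<le> eccentricity (complement G) v"
    unfolding eccentricity_def by (auto intro: SUP_upper2)
qed

lemma not_bipartite_complement:
  assumes "pair_bidirected_digraph G" "connected (with_proj G)" "3 \<le> radius G"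
    and "pverts G \<noteq> {}"
  shows "\<not> bipartite (complement G)"
proof
  assume "bipartite (complement G)"
  then obtain A B where "A \<inter> B = {}"
    and "\<forall>(u, v) \<in> parcs (complement G). (u \<in> A \<and> v \<in> B) \<or> (u \<in> B \<and> v \<in> A)"
    unfolding bipartite_def by blast
  then have sides: "(u \<in> A) \<noteq> (v \<in> A)" if "(u, v) \<in> parcs (complement G)" for u v
    using that by blast
  have "(u \<in> A) = (v \<in> A)" if "(u, v) \<in> parcs G" for u v
    using edge_common_nonneighbour[OF assms(1,3) that] sides by blast
  then have const: "(u \<in> A) = (v \<in> A)" if "u \<in> pverts G" "v \<in> pverts G" for u v
    using connected_imp_constant[OF assms(2), of "\<lambda>x. x \<in> A"] that by blast
  obtain a where "a \<in> pverts G"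
    using assms(4) by blast
  moreover have "0 < radius G"
    using assms(3) by (rule less_le_trans[rotated]) simp
  ultimately obtain b where "(a, b) \<in> parcs G"
    using connected_imp_neighbour[OF assms(1,2)] by blast
  then obtain w where "(a, w) \<in> parcs (complement G)"
    using edge_common_nonneighbour[OF assms(1,3)] by blast
  then show False
    using sides const by auto
qed

theorem theorem2p10:
  fixes T :: "'a pair_pre_digraph"
  assumes "undirected_tree T"
    and "radius T \<ge> 3"
    and "distinguishing_number T = 2"
  shows "connected (with_proj (complement T)) \<and> self_centered 2 (complement T)
    \<and> \<not> bipartite (complement T)"
proof -
  have T: "pair_bidirected_digraph T" "connected (with_proj T)"
    using assms(1) by (auto simp: undirected_tree_def)
  then have "pverts T \<noteq> {}"
    by (simp add: connected_conv)
  moreover from this have "self_centered 2 (complement T)"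
    using eccentricity_complement[OF T assms(2)]
    by (intro self_centeredI) (simp_all add: numeral_eq_enat)
  ultimately show ?thesis
    using T assms(2) by (simp add: connected_complement not_bipartite_complement)
qed

end
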